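(* Let $D\subseteq\mathbb{C}^{n\times m}$, let $F:D\times D\to D$ satisfy $F(F(X,Y),Z)=F(X,F(Y,Z))$ for all $X,Y,Z\in D$, let $X_1\in D$, and let $\{X_k\}_{k\ge1}$ be defined by $X_{k+1}=F(X_k,X_1)$ for $k\ge1$. Let $r>1$ be an integer, and let $\{\widehat{X}_k\}_{k\ge1}$ be the sequence produced by the accelerated algorithm (defined in the context) with parameter $r$ and $\widehat{X}_1=X_1$. If $\{X_k\}$ converges R-linearly to $X_*$ and $\|X_k-X_*\|=o(\rho^k)$ for a constant $0<\rho<1$, then $\|\widehat{X}_k-X_*\|=o(\rho^{r^k})$. In other words, $\{\widehat{X}_k\}$ converges R-superlinearly to $X_*$ with order $r$ provided that $\{X_k\}$ converges R-linearly to $X_*$.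
   Context: Accelerated algorithm with parameter $r>1$: set $\widehat{X}_1=X_1$. For each $k\ge1$, put $X_k^{(1)}=\widehat{X}_k$, then $X_k^{(\ell+1)}=F(\widehat{X}_k,X_k^{(\ell)})$ for $\ell=1,\ldots,r-2$, and finally $\widehat{X}_{k+1}=F(\widehat{X}_k,X_k^{(r-1)})$. Convergence notions, for a sequence of matrices $\{Y_k\}$ and an induced matrix norm $\|\cdot\|$: $Y_k$ converges R-linearly to $Y_*$ if $\limsup_{k\to\infty}\|Y_k-Y_*\|^{1/k}\le\sigma$ for some $\sigma\in(0,1)$. For an integer $r>1$, $Y_k$ converges R-superlinearly to $Y_*$ with order $r$ if $\limsup_{k\to\infty}\|Y_k-Y_*\|^{1/r^k}\le\sigma$ for some $\sigma\in(0,1)$.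
   Formalization: The rate o(ρ^{r^k}) with the same ρ is false since X̂_k = X_{r^{k-1}} (scalars, X_k=2^{-k}, r=2, ρ=3/5); it is replaced by o(ρ^{r^{k-1}}) and by o(τ^{r^k}) for some τ in (0,1). *)

theory Defs
  imports "HOL-Analysis.Analysis" "HOL-Library.Landau_Symbols"
begin

definition is_vector_norm :: "(complex ^ 'n \<Rightarrow> real) \<Rightarrow> bool" where
  "is_vector_norm N \<longleftrightarrow>
     (\<forall>x. 0 \<le> N x) \<and> (\<forall>x. N x = 0 \<longleftrightarrow> x = 0) \<and>
     (\<forall>c x. N (c *s x) = cmod c * N x) \<and> (\<forall>x y. N (x + y) \<le> N x + N y)"

definition induced_norm ::
  "(complex ^ 'n \<Rightarrow> real) \<Rightarrow> (complex ^ 'm \<Rightarrow> real) \<Rightarrow> complex ^ 'm ^ 'n \<Rightarrow> real" where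
  "induced_norm N N' A = (SUP x\<in>{x. x \<noteq> 0}. N (A *v x) / N' x)"

definition R_linear ::
  "(complex ^ 'm ^ 'n \<Rightarrow> real) \<Rightarrow> (nat \<Rightarrow> complex ^ 'm ^ 'n) \<Rightarrow> complex ^ 'm ^ 'n \<Rightarrow> bool" where
  "R_linear \<nu> Y Ys \<longleftrightarrow>
     (\<exists>\<sigma>::real. 0 < \<sigma> \<and> \<sigma> < 1 \<and>
        limsup (\<lambda>k. ereal (\<nu> (Y k - Ys) powr (1 / real k))) \<le> ereal \<sigma>)"

(* meant for r > 1 *)
definition R_superlinear ::
  "(complex ^ 'm ^ 'n \<Rightarrow> real) \<Rightarrow> nat \<Rightarrow> (nat \<Rightarrow> complex ^ 'm ^ 'n) \<Rightarrow> complex ^ 'm ^ 'n \<Rightarrow> bool" where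
  "R_superlinear \<nu> r Y Ys \<longleftrightarrow>
     (\<exists>\<sigma>::real. 0 < \<sigma> \<and> \<sigma> < 1 \<and>
        limsup (\<lambda>k. ereal (\<nu> (Y k - Ys) powr (1 / real (r ^ k)))) \<le> ereal \<sigma>)"

(* Sequences are indexed from 1; the value at index 0 is unconstrained. *)

definition fixed_point_iteration :: "('a \<Rightarrow> 'a \<Rightarrow> 'a) \<Rightarrow> 'a \<Rightarrow> (nat \<Rightarrow> 'a) \<Rightarrow> bool" where
  "fixed_point_iteration F X1 X \<longleftrightarrow> X 1 = X1 \<and> (\<forall>k\<ge>1. X (k + 1) = F (X k) X1)"

(* Z l is the inner iterate X_k^(l); the range {1..r - 2} is empty when r = 2.
   Because Xh 1 = X1, associativity of F yields Xh k = X (r ^ (k - 1)) and not X (r ^ k); an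
   estimate o(\<rho> ^ k) for X hence becomes o(\<rho> ^ (r ^ (k - 1))) for Xh, which is
   o(\<tau> ^ (r ^ k)) for \<tau> = root r \<rho>. The order of convergence is r either way. *)
definition accelerated_iteration ::
  "('a \<Rightarrow> 'a \<Rightarrow> 'a) \<Rightarrow> nat \<Rightarrow> 'a \<Rightarrow> (nat \<Rightarrow> 'a) \<Rightarrow> bool" where
  "accelerated_iteration F r X1 Xh \<longleftrightarrow>
     Xh 1 = X1 \<and>
     (\<forall>k\<ge>1. \<exists>Z :: nat \<Rightarrow> 'a.
        Z 1 = Xh k \<and>
        (\<forall>l\<in>{1..r - 2}. Z (l + 1) = F (Xh k) (Z l)) \<and>
        Xh (k + 1) = F (Xh k) (Z (r - 1)))"

end

theory Submission
  imports Defs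
begin

text \<open>
  The associativity law makes the orbit of \<open>X1\<close> a one-generator semigroup in which \<open>X k\<close> plays
  the role of the \<open>k\<close>-th power of \<open>X1\<close>: \<open>F (X a) (X b) = X (a + b)\<close>
  (\<open>fixed_point_iteration_add\<close>). One accelerated step multiplies \<open>r\<close> copies of the current iterate
  together, so it raises a power to its \<open>r\<close>-th power, and from \<open>Xh 1 = X 1\<close> one gets
  \<open>Xh k = X (r ^ (k - 1))\<close> (\<open>accelerated_iteration_eq\<close>). The accelerated sequence is thus a
  subsequence of the original one, and every estimate for \<open>X\<close> is inherited along the indices
  \<open>r ^ (k - 1)\<close>.

  The passage from the exponent \<open>r ^ (k - 1)\<close> to the exponent \<open>r ^ k\<close> costs an \<open>r\<close>-th root of the
  base: \<open>\<rho> ^ (r ^ (k - 1)) = \<tau> ^ (r ^ k)\<close> for \<open>\<tau> = root r \<rho>\<close>, and an \<open>r\<close>-th root of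
  a number in \<open>(0, 1)\<close> is again in \<open>(0, 1)\<close>. The same root appears in the R-superlinear bound
  (\<open>R_linear_imp_R_superlinear\<close>).
\<close>

lemma fixed_point_iteration_in:
  assumes closed: "\<And>A B. A \<in> D \<Longrightarrow> B \<in> D \<Longrightarrow> F A B \<in> D"
    and X1: "X1 \<in> D" and X: "fixed_point_iteration F X1 X" and "k \<ge> 1"
  shows "X k \<in> D"
  using \<open>k \<ge> 1\<close>
proof (induction k rule: dec_induct)
  case base
  show ?case using X X1 by (simp add: fixed_point_iteration_def)
next
  case (step k)
  then show ?case using X X1 closed by (simp add: fixed_point_iteration_def)
qed

text \<open>The law of exponents in the semigroup generated by \<open>X1\<close>. The recursion multiplies by \<open>X1\<close>
  on the right, so associativity moves the last factor over to \<open>X b\<close>.\<close>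

lemma fixed_point_iteration_add:
  assumes closed: "\<And>A B. A \<in> D \<Longrightarrow> B \<in> D \<Longrightarrow> F A B \<in> D"
    and assoc: "\<And>A B C. A \<in> D \<Longrightarrow> B \<in> D \<Longrightarrow> C \<in> D \<Longrightarrow> F (F A B) C = F A (F B C)"
    and X1: "X1 \<in> D" and X: "fixed_point_iteration F X1 X" and "a \<ge> 1" and "b \<ge> 1"
  shows "F (X a) (X b) = X (a + b)"
  using \<open>b \<ge> 1\<close>
proof (induction b rule: dec_induct)
  case base
  show ?case using X \<open>a \<ge> 1\<close> by (simp add: fixed_point_iteration_def)
next
  case (step b)
  have rec: "X (Suc k) = F (X k) X1" if "k \<ge> 1" for k
    using X that by (simp add: fixed_point_iteration_def)
  have mem: "X k \<in> D" if "k \<ge> 1" for k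
    using fixed_point_iteration_in[OF closed X1 X that] .
  have "F (X a) (X (Suc b)) = F (X a) (F (X b) X1)"
    using rec step.hyps by simp
  also have "\<dots> = F (F (X a) (X b)) X1"
    using assoc mem X1 \<open>a \<ge> 1\<close> step.hyps by simp
  also have "\<dots> = X (a + Suc b)"
    using step rec[of "a + b"] by simp
  finally show ?case .
qed

lemma accelerated_iteration_eq:
  assumes closed: "\<And>A B. A \<in> D \<Longrightarrow> B \<in> D \<Longrightarrow> F A B \<in> D"
    and assoc: "\<And>A B C. A \<in> D \<Longrightarrow> B \<in> D \<Longrightarrow> C \<in> D \<Longrightarrow> F (F A B) C = F A (F B C)"
    and X1: "X1 \<in> D" and X: "fixed_point_iteration F X1 X"
    and r: "r > 1" and Xh: "accelerated_iteration F r X1 Xh" and "k \<ge> 1"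
  shows "Xh k = X (r ^ (k - 1))"
  using \<open>k \<ge> 1\<close>
proof (induction k rule: dec_induct)
  case base
  show ?case using X Xh by (simp add: fixed_point_iteration_def accelerated_iteration_def)
next
  case (step k)
  define p where "p = r ^ (k - 1)"
  have p: "p \<ge> 1" using r by (simp add: p_def)
  have Xhk: "Xh k = X p" using step.IH by (simp add: p_def)
  obtain Z where Z1: "Z 1 = Xh k"
    and Z: "\<And>l. l \<in> {1..r - 2} \<Longrightarrow> Z (l + 1) = F (Xh k) (Z l)"
    and last: "Xh (k + 1) = F (Xh k) (Z (r - 1))"
    using Xh step.hyps unfolding accelerated_iteration_def by blast
  have add: "F (X p) (X (l * p)) = X (Suc l * p)" if "l \<ge> 1" for l
    using fixed_point_iteration_add[OF closed assoc X1 X p, of "l * p"] p that by simp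
  \<comment> \<open>The inner loop runs through the successive powers of \<open>X p\<close>.\<close>
  have inner: "l \<le> r - 1 \<longrightarrow> Z l = X (l * p)" if "l \<ge> 1" for l
    using that
  proof (induction l rule: dec_induct)
    case base
    show ?case using Z1 Xhk by simp
  next
    case (step l)
    then show ?case using Z[of l] Xhk add[of l] by auto
  qed
  have "Xh (Suc k) = X (Suc (r - 1) * p)"
    using last Xhk inner[of "r - 1"] add[of "r - 1"] r by simp
  also have "Suc (r - 1) * p = r ^ (Suc k - 1)"
    using r step.hyps by (simp add: p_def power_eq_if)
  finally show ?case .
qed

lemma filterlim_power_pred:
  fixes r :: nat
  assumes "r > 1"
  shows "filterlim (\<lambda>k. r ^ (k - 1)) at_top sequentially"
proof (rule filterlim_at_top_mono[OF filterlim_minus_const_nat_at_top])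
  show "\<forall>\<^sub>F k in sequentially. k - 1 \<le> r ^ (k - 1)"
    using assms by (intro always_eventually allI less_imp_le power_gt_expt) simp
qed

lemma root_power_power:
  assumes "\<rho> \<ge> 0" and "r \<ge> 1" and "k \<ge> 1"
  shows "root r \<rho> ^ (r ^ k) = \<rho> ^ (r ^ (k - 1))"
proof -
  have "root r \<rho> ^ (r ^ k) = (root r \<rho> ^ r) ^ (r ^ (k - 1))"
    using \<open>k \<ge> 1\<close> by (cases k) (simp_all add: power_mult)
  then show ?thesis using assms by simp
qed

text \<open>With \<open>p = r ^ (k - 1)\<close>, the root of order \<open>r ^ k\<close> of the error of \<open>Y\<close> at index \<open>p\<close> is the
  \<open>r\<close>-th root of its root of order \<open>p\<close>. R-linear convergence eventually bounds the latter by some \<open>s < 1\<close>.\<close>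

lemma R_linear_imp_R_superlinear:
  assumes lin: "R_linear \<nu> Y Ys" and r: "r > 1"
    and sub: "\<And>k. k \<ge> 1 \<Longrightarrow> Yh k = Y (r ^ (k - 1))"
  shows "R_superlinear \<nu> r Yh Ys"
proof -
  obtain \<sigma> where \<sigma>: "0 < \<sigma>" "\<sigma> < 1"
    and lim: "limsup (\<lambda>k. ereal (\<nu> (Y k - Ys) powr (1 / real k))) \<le> ereal \<sigma>"
    using lin unfolding R_linear_def by blast
  \<comment> \<open>A limsup bound holds eventually only after enlarging it.\<close>
  obtain s where s: "\<sigma> < s" "s < 1" using dense[OF \<sigma>(2)] by blast
  have "limsup (\<lambda>k. ereal (\<nu> (Y k - Ys) powr (1 / real k))) < ereal s"
    using le_less_trans[OF lim] s by simp
  then have "\<forall>\<^sub>F k in sequentially. \<nu> (Y k - Ys) powr (1 / real k) < s"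
    by (auto dest: Limsup_lessD)
  then have ev: "\<forall>\<^sub>F k in sequentially.
      \<nu> (Y (r ^ (k - 1)) - Ys) powr (1 / real (r ^ (k - 1))) < s"
    using filterlim_power_pred[OF r] by (auto simp: filterlim_iff)
  have "\<forall>\<^sub>F k in sequentially.
      ereal (\<nu> (Yh k - Ys) powr (1 / real (r ^ k))) \<le> ereal (s powr (1 / real r))"
    using ev eventually_ge_at_top[of 1]
  proof eventually_elim
    case (elim k)
    have "\<nu> (Yh k - Ys) powr (1 / real (r ^ k)) =
        (\<nu> (Y (r ^ (k - 1)) - Ys) powr (1 / real (r ^ (k - 1)))) powr (1 / real r)"
      using elim(2) by (cases k) (simp_all add: sub powr_powr mult.commute)
    also have "\<dots> \<le> s powr (1 / real r)"
      using elim(1) by (intro powr_mono2) auto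
    finally show ?case by simp
  qed
  then have "limsup (\<lambda>k. ereal (\<nu> (Yh k - Ys) powr (1 / real (r ^ k))))
      \<le> ereal (s powr (1 / real r))"
    by (rule Limsup_bounded)
  moreover have "0 < s powr (1 / real r)" "s powr (1 / real r) < 1"
    using s \<sigma> r powr_less_mono2[of "1 / real r" s 1] by auto
  ultimately show ?thesis unfolding R_superlinear_def by blast
qed

theorem mainTheorem2:
  fixes D :: "(complex ^ 'm ^ 'n) set"
    and F :: "complex ^ 'm ^ 'n \<Rightarrow> complex ^ 'm ^ 'n \<Rightarrow> complex ^ 'm ^ 'n"
    and X1 Xs :: "complex ^ 'm ^ 'n"
    and X Xh :: "nat \<Rightarrow> complex ^ 'm ^ 'n"
    and r :: nat
    and N :: "complex ^ 'n \<Rightarrow> real" and N' :: "complex ^ 'm \<Rightarrow> real"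
  assumes "is_vector_norm N" and "is_vector_norm N'"
    and "\<And>A B. A \<in> D \<Longrightarrow> B \<in> D \<Longrightarrow> F A B \<in> D"
    and "\<And>A B C. A \<in> D \<Longrightarrow> B \<in> D \<Longrightarrow> C \<in> D \<Longrightarrow> F (F A B) C = F A (F B C)"
    and "X1 \<in> D"
    and "fixed_point_iteration F X1 X"
    and "r > 1"
    and "accelerated_iteration F r X1 Xh"
    and "R_linear (induced_norm N N') X Xs"
  shows "(\<forall>\<rho>::real. 0 < \<rho> \<longrightarrow> \<rho> < 1 \<longrightarrow>
            (\<lambda>k. induced_norm N N' (X k - Xs)) \<in> o(\<lambda>k. \<rho> ^ k) \<longrightarrow>
            (\<lambda>k. induced_norm N N' (Xh k - Xs)) \<in> o(\<lambda>k. \<rho> ^ (r ^ (k - 1))) \<and>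
            (\<exists>\<tau>::real. 0 < \<tau> \<and> \<tau> < 1 \<and>
               (\<lambda>k. induced_norm N N' (Xh k - Xs)) \<in> o(\<lambda>k. \<tau> ^ (r ^ k)))) \<and>
         R_superlinear (induced_norm N N') r Xh Xs"
proof (intro conjI allI impI)
  have Xh: "Xh k = X (r ^ (k - 1))" if "k \<ge> 1" for k
    using accelerated_iteration_eq[OF assms(3-8) that] .
  show "R_superlinear (induced_norm N N') r Xh Xs"
    using R_linear_imp_R_superlinear[OF assms(9,7) Xh] .
  fix \<rho> :: real
  assume \<rho>: "0 < \<rho>" "\<rho> < 1"
    and small: "(\<lambda>k. induced_norm N N' (X k - Xs)) \<in> o(\<lambda>k. \<rho> ^ k)"
  have "(\<lambda>k. induced_norm N N' (X (r ^ (k - 1)) - Xs)) \<in> o(\<lambda>k. \<rho> ^ (r ^ (k - 1)))"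
    using landau_o.small.compose[OF small filterlim_power_pred[OF assms(7)]] .
  moreover have "\<forall>\<^sub>F k in sequentially.
      induced_norm N N' (X (r ^ (k - 1)) - Xs) = induced_norm N N' (Xh k - Xs)"
    using eventually_ge_at_top[of 1] by eventually_elim (simp add: Xh)
  ultimately show *: "(\<lambda>k. induced_norm N N' (Xh k - Xs)) \<in> o(\<lambda>k. \<rho> ^ (r ^ (k - 1)))"
    by (simp cong: landau_o.small.in_cong)
  have "\<forall>\<^sub>F k in sequentially. \<rho> ^ (r ^ (k - 1)) = root r \<rho> ^ (r ^ k)"
    using eventually_ge_at_top[of 1]
    by eventually_elim (use \<rho> assms(7) in \<open>simp add: root_power_power\<close>)
  then have "(\<lambda>k. induced_norm N N' (Xh k - Xs)) \<in> o(\<lambda>k. root r \<rho> ^ (r ^ k))"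
    using * by (simp cong: landau_o.small.cong)
  moreover have "0 < root r \<rho>" "root r \<rho> < 1"
    using \<rho> assms(7) by simp_all
  ultimately show "\<exists>\<tau>::real. 0 < \<tau> \<and> \<tau> < 1 \<and>
      (\<lambda>k. induced_norm N N' (Xh k - Xs)) \<in> o(\<lambda>k. \<tau> ^ (r ^ k))"
    by blast
qed

end
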